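(* Let $\mathcal{D}$ be a distributive lattice, and let $L_{\mathcal{D}}$ (resp. $X_{\mathcal{D}}$) be its associated Stone locale (resp. Stone space). Then the following conditions are equivalent: (i) $L_{\mathcal{D}}$ (equivalently, $X_{\mathcal{D}}$) is almost discrete; (ii) for any ideal $I$ of $\mathcal{D}$, if $a\in\mathcal{D}$ is an element such that for any non-zero element $b\le a$ there exists a non-zero element $c\in I$ with $c\le b$, then $a\in I$; (iii) for any collection $\{a_i\mid i\in I\}$ of non-zero elements of $\mathcal{D}$ with the property that for any non-zero element $a$ there exists $i\in I$ such that $a_i\wedge a\neq0$, there exists a finite subset $J\subseteq I$ such that $1=\bigvee_{i\in J}a_i$; (iv) every element of $\mathcal{D}$ is complemented in $\mathcal{D}$, $\mathcal{D}$ is complete, and the supremum in $\mathcal{D}$ of any subset $S$ of $\mathcal{D}$ is a finite join of elements of $S$; (v) $\mathcal{D}$ is a finite Boolean algebra.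
   Context: Distributive lattices have $0$ and $1$. The Stone locale $L_{\mathcal{D}}$ is the locale whose frame is the set of ideals of $\mathcal{D}$ (lower sets containing $0$ and closed under binary joins) ordered by inclusion. The Stone space $X_{\mathcal{D}}$ is the set of prime filters of $\mathcal{D}$ with the topology having as basis the sets $\{F\mid d\in F\}$, $d\in\mathcal{D}$ (the axiom of choice is assumed for the identification of its frame of open sets with $L_{\mathcal{D}}$). A locale is almost discrete if every element is complemented; a space is almost discrete if every open set is closed. *)

theory Defs
  imports "HOL-Library.Lub_Glb" "HOL-Analysis.Abstract_Topology"
begin

section \<open>Complements and finite joins\<close>

definition complemented :: "'a::bounded_lattice \<Rightarrow> bool"
  where "complemented a \<longleftrightarrow> (\<exists>b. inf a b = bot \<and> sup a b = top)"

text \<open>\<^const>\<open>Sup_fin\<close> is only specified on nonempty finite sets; inserting \<^const>\<open>bot\<close> makes the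
  empty join equal to 0 and changes nothing otherwise.\<close>

definition finite_join :: "'a::bounded_lattice set \<Rightarrow> 'a"
  where "finite_join S = Sup_fin (insert bot S)"

lemma finite_join_empty: "finite_join {} = bot"
  by (simp add: finite_join_def)

lemma isLub_finite_join:
  assumes "finite S"
  shows "isLub UNIV S (finite_join S)"
proof (rule isLubI2)
  show "isUb UNIV S (finite_join S)"
    unfolding finite_join_def using assms by (auto intro!: isUbI setleI Sup_fin.coboundedI)
  show "finite_join S <=* Collect (isUb UNIV S)"
    unfolding finite_join_def using assms
    by (auto intro!: setgeI Sup_fin.boundedI dest: isUbD)
qed

definition order_complete :: "'a::order itself \<Rightarrow> bool"
  where "order_complete _ \<longleftrightarrow> (\<forall>S::'a set. (\<exists>s. isLub UNIV S s) \<and> (\<exists>i. isGlb UNIV S i))"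

definition is_boolean_algebra :: "'a::{distrib_lattice,bounded_lattice} itself \<Rightarrow> bool"
  where "is_boolean_algebra _ \<longleftrightarrow>
    (\<exists>(diff :: 'a \<Rightarrow> 'a \<Rightarrow> 'a) compl.
       class.boolean_algebra diff compl inf (\<le>) (<) sup bot top)"


section \<open>Locales and topological spaces\<close>

text \<open>A locale is represented by its frame.\<close>

class frame = complete_lattice +
  assumes inf_Sup_le: "inf x (Sup A) \<le> (SUP a\<in>A. inf x a)"

lemma (in frame) inf_Sup_frame: "inf x (Sup A) = (SUP a\<in>A. inf x a)"
  by (intro order.antisym inf_Sup_le SUP_least inf_mono Sup_upper order.refl)

definition almost_discrete_locale :: "'a::frame itself \<Rightarrow> bool"
  where "almost_discrete_locale _ \<longleftrightarrow> (\<forall>x::'a. complemented x)"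

definition almost_discrete_space :: "'a topology \<Rightarrow> bool"
  where "almost_discrete_space X \<longleftrightarrow> (\<forall>U. openin X U \<longrightarrow> closedin X U)"


section \<open>The Stone locale\<close>

definition is_ideal :: "'a::bounded_lattice set \<Rightarrow> bool"
  where "is_ideal I \<longleftrightarrow> bot \<in> I \<and> (\<forall>a\<in>I. \<forall>b. b \<le> a \<longrightarrow> b \<in> I) \<and> (\<forall>a\<in>I. \<forall>b\<in>I. sup a b \<in> I)"

lemma is_ideal_Inter: "(\<And>I. I \<in> \<I> \<Longrightarrow> is_ideal I) \<Longrightarrow> is_ideal (\<Inter>\<I>)"
  unfolding is_ideal_def by blast

typedef (overloaded) 'a stone_locale = "{I :: 'a::{distrib_lattice,bounded_lattice} set. is_ideal I}"
  morphisms ideal_set Abs_stone_locale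
  by (rule exI[of _ UNIV]) (simp add: is_ideal_def)

setup_lifting type_definition_stone_locale

instantiation stone_locale :: ("{distrib_lattice,bounded_lattice}") complete_lattice
begin

lift_definition less_eq_stone_locale :: "'a stone_locale \<Rightarrow> 'a stone_locale \<Rightarrow> bool" is "(\<subseteq>)" .

lift_definition less_stone_locale :: "'a stone_locale \<Rightarrow> 'a stone_locale \<Rightarrow> bool" is "(\<subset>)" .

lift_definition inf_stone_locale :: "'a stone_locale \<Rightarrow> 'a stone_locale \<Rightarrow> 'a stone_locale" is "(\<inter>)"
  by (auto simp: is_ideal_def)

lift_definition Inf_stone_locale :: "'a stone_locale set \<Rightarrow> 'a stone_locale" is "\<lambda>\<I>. \<Inter>\<I>"
  by (auto intro: is_ideal_Inter)

definition "Sup \<A> = Inf {K :: 'a stone_locale. \<forall>I\<in>\<A>. I \<le> K}"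

definition "sup I J = Inf {K :: 'a stone_locale. I \<le> K \<and> J \<le> K}"

definition "bot = (Inf UNIV :: 'a stone_locale)"

definition "top = (Inf {} :: 'a stone_locale)"

instance
proof
  fix x y z :: "'a stone_locale" and A :: "'a stone_locale set"
  show "x < y \<longleftrightarrow> x \<le> y \<and> \<not> y \<le> x" by transfer auto
  show "x \<le> x" by transfer auto
  show "x \<le> y \<Longrightarrow> y \<le> z \<Longrightarrow> x \<le> z" by transfer auto
  show "x \<le> y \<Longrightarrow> y \<le> x \<Longrightarrow> x = y" by transfer auto
  show "inf x y \<le> x" by transfer auto
  show "inf x y \<le> y" by transfer auto
  show "x \<le> y \<Longrightarrow> x \<le> z \<Longrightarrow> x \<le> inf y z" by transfer auto
  have Inf_lower: "\<And>w B. w \<in> B \<Longrightarrow> Inf B \<le> (w :: 'a stone_locale)" by transfer auto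
  have Inf_greatest: "\<And>w B. (\<And>v. v \<in> B \<Longrightarrow> w \<le> v) \<Longrightarrow> w \<le> (Inf B :: 'a stone_locale)"
    by (simp add: less_eq_stone_locale.rep_eq Inf_stone_locale.rep_eq) blast
  show "x \<in> A \<Longrightarrow> Inf A \<le> x" by (rule Inf_lower)
  show "(\<And>w. w \<in> A \<Longrightarrow> z \<le> w) \<Longrightarrow> z \<le> Inf A" by (rule Inf_greatest)
  show "x \<le> sup x y" "y \<le> sup x y" unfolding sup_stone_locale_def by (auto intro: Inf_greatest)
  show "y \<le> x \<Longrightarrow> z \<le> x \<Longrightarrow> sup y z \<le> x" unfolding sup_stone_locale_def by (auto intro: Inf_lower)
  show "x \<in> A \<Longrightarrow> x \<le> Sup A" unfolding Sup_stone_locale_def by (auto intro: Inf_greatest)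
  show "(\<And>w. w \<in> A \<Longrightarrow> w \<le> z) \<Longrightarrow> Sup A \<le> z" unfolding Sup_stone_locale_def by (auto intro: Inf_lower)
  show "Inf {} = (top :: 'a stone_locale)" by (simp add: top_stone_locale_def)
  show "Sup {} = (bot :: 'a stone_locale)" by (simp add: bot_stone_locale_def Sup_stone_locale_def)
qed

end

lemma ideal_set_is_ideal: "is_ideal (ideal_set I)"
  using ideal_set by auto

instance stone_locale :: ("{distrib_lattice,bounded_lattice}") frame
proof
  fix x :: "'a stone_locale" and A
  define K where "K = (SUP a\<in>A. inf x a)"
  define M where "M = {z. \<forall>w\<in>ideal_set x. inf w z \<in> ideal_set K}"
  have down: "\<And>a b. a \<in> ideal_set K \<Longrightarrow> b \<le> a \<Longrightarrow> b \<in> ideal_set K"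
    and join: "\<And>a b. a \<in> ideal_set K \<Longrightarrow> b \<in> ideal_set K \<Longrightarrow> sup a b \<in> ideal_set K"
    and zero: "bot \<in> ideal_set K"
    using ideal_set_is_ideal[of K] unfolding is_ideal_def by blast+
  have "is_ideal M"
    unfolding is_ideal_def
  proof (intro conjI ballI allI impI)
    show "bot \<in> M" using zero by (simp add: M_def)
  next
    fix a b assume a: "a \<in> M" and "b \<le> a"
    then have "inf w b \<le> inf w a" for w by (intro inf_mono order_refl)
    then show "b \<in> M" using a down unfolding M_def by blast
  next
    fix a b assume "a \<in> M" "b \<in> M"
    then show "sup a b \<in> M" using join by (simp add: M_def inf_sup_distrib1)
  qed
  then have M: "ideal_set (Abs_stone_locale M) = M" by (simp add: Abs_stone_locale_inverse)
  have "a \<le> Abs_stone_locale M" if "a \<in> A" for a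
  proof -
    have le: "ideal_set x \<inter> ideal_set a \<subseteq> ideal_set K"
      using SUP_upper[OF that, of "inf x"]
      by (simp add: K_def less_eq_stone_locale.rep_eq inf_stone_locale.rep_eq)
    have "inf w z \<in> ideal_set K" if "z \<in> ideal_set a" "w \<in> ideal_set x" for z w
    proof -
      have "inf w z \<in> ideal_set x" "inf w z \<in> ideal_set a"
        using ideal_set_is_ideal[of x] ideal_set_is_ideal[of a] that
        by (auto simp: is_ideal_def)
      then show ?thesis using le by blast
    qed
    then have "ideal_set a \<subseteq> M" unfolding M_def by blast
    then show ?thesis by (simp add: less_eq_stone_locale.rep_eq M)
  qed
  then have "Sup A \<le> Abs_stone_locale M" by (rule Sup_least)
  then have "ideal_set (Sup A) \<subseteq> M" by (simp add: less_eq_stone_locale.rep_eq M)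
  then have "ideal_set (inf x (Sup A)) \<subseteq> ideal_set K"
    by (fastforce simp: inf_stone_locale.rep_eq M_def)
  then show "inf x (Sup A) \<le> (SUP a\<in>A. inf x a)"
    by (simp add: K_def less_eq_stone_locale.rep_eq)
qed


section \<open>The Stone space\<close>

definition prime_filter :: "'a::bounded_lattice set \<Rightarrow> bool"
  where "prime_filter F \<longleftrightarrow>
    top \<in> F \<and> (\<forall>a\<in>F. \<forall>b. a \<le> b \<longrightarrow> b \<in> F) \<and> (\<forall>a\<in>F. \<forall>b\<in>F. inf a b \<in> F) \<and>
    bot \<notin> F \<and> (\<forall>a b. sup a b \<in> F \<longrightarrow> a \<in> F \<or> b \<in> F)"

definition stone_basic :: "'a::bounded_lattice \<Rightarrow> 'a set set"
  where "stone_basic d = {F. prime_filter F \<and> d \<in> F}"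

definition stone_space :: "'a::{distrib_lattice,bounded_lattice} set topology"
  where "stone_space = topology (arbitrary union_of (\<lambda>U. \<exists>d. U = stone_basic d))"

text \<open>The basic sets are closed under intersection, so \<^const>\<open>topology\<close> is applied to a genuine
  topology, whose points are exactly the prime filters.\<close>

lemma stone_basic_inf: "stone_basic a \<inter> stone_basic b = stone_basic (inf a b)"
  unfolding stone_basic_def prime_filter_def by (auto intro: inf_le1 inf_le2)

lemma openin_stone_space:
  "openin stone_space = arbitrary union_of (\<lambda>U. \<exists>d. U = stone_basic d)"
  unfolding stone_space_def
  by (rule topology_inverse', rule istopology_base) (auto simp: stone_basic_inf)

lemma topspace_stone_space:
  "topspace stone_space = {F :: 'a::{distrib_lattice,bounded_lattice} set. prime_filter F}"
proof -
  have *: "stone_basic top = {F :: 'a set. prime_filter F}"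
    by (auto simp: stone_basic_def prime_filter_def)
  have "openin stone_space (stone_basic (top :: 'a))"
    unfolding openin_stone_space by (rule arbitrary_union_of_inc) blast
  moreover have "U \<subseteq> stone_basic top" if "openin stone_space U" for U :: "'a set set"
    using that unfolding openin_stone_space *
    by (auto simp: union_of_def stone_basic_def)
  ultimately show ?thesis unfolding * [symmetric] by (meson openin_topspace openin_subset order.antisym)
qed


section \<open>Finite subcovers of dense families\<close>

text \<open>Families are indexed here by subsets of the lattice itself, since the index type cannot be
  quantified inside a formula; the lemma below shows that this covers every index type.\<close>

definition dense_family :: "'i set \<Rightarrow> ('i \<Rightarrow> 'a::bounded_lattice) \<Rightarrow> bool"
  where "dense_family I a \<longleftrightarrow>
    (\<forall>i\<in>I. a i \<noteq> bot) \<and> (\<forall>b. b \<noteq> bot \<longrightarrow> (\<exists>i\<in>I. inf (a i) b \<noteq> bot))"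

definition dense_families_finitely_cover :: "'a::bounded_lattice itself \<Rightarrow> bool"
  where "dense_families_finitely_cover _ \<longleftrightarrow>
    (\<forall>(I::'a set) (a::'a \<Rightarrow> 'a). dense_family I a \<longrightarrow>
       (\<exists>J. finite J \<and> J \<subseteq> I \<and> top = finite_join (a ` J)))"

lemma dense_families_finitely_cover_any_index:
  fixes I :: "'i set" and a :: "'i \<Rightarrow> 'a::bounded_lattice"
  assumes "dense_families_finitely_cover TYPE('a)" and "dense_family I a"
  shows "\<exists>J. finite J \<and> J \<subseteq> I \<and> top = finite_join (a ` J)"
proof -
  have "dense_family (a ` I) (\<lambda>x. x)"
    using assms(2) by (auto simp: dense_family_def)
  then obtain K where "finite K" "K \<subseteq> a ` I" "top = finite_join ((\<lambda>x. x) ` K)"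
    using assms(1) unfolding dense_families_finitely_cover_def by blast
  then show ?thesis by (metis finite_subset_image image_ident)
qed

end

theory Submission
  imports Defs
begin

text \<open>All five conditions, and the one on the Stone space, say that every ideal is the set of
  elements below some complemented element \<open>i\<close>. For the Stone locale this holds because a complement
  \<open>J\<close> of an ideal \<open>I\<close> must satisfy \<open>1 = i \<squnion> j\<close> with \<open>i \<in> I\<close>, \<open>j \<in> J\<close>, while \<open>j\<close> is disjoint from
  all of \<open>I\<close>; hence \<open>x = (x \<sqinter> i) \<squnion> (x \<sqinter> j) = x \<sqinter> i\<close> for \<open>x \<in> I\<close>
  (\<open>complemented_stone_locale_iff\<close>).

  The only possible complement of an ideal \<open>I\<close> is its annihilator \<open>A\<close>, and a nonzero element either
  meets some element of \<open>I\<close> or lies in \<open>A\<close>, so the nonzero elements of \<open>I \<union> A\<close> always form a dense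
  family (\<open>ideal_or_annihilator_below\<close>). The closure condition on ideals and the covering condition on
  dense families are two ways of asking that this density force \<open>1\<close> into the ideal generated by
  \<open>I \<union> A\<close>. When suprema exist and are finite joins, an ideal contains its own supremum and is
  therefore principal; conversely, a finite Boolean algebra has all such suprema.

  For finiteness, principality of the ideals yields the ascending chain condition, and
  a complemented distributive lattice with this condition is finite: if \<open>a < b < 1\<close>, then \<open>b\<close> has a
  complement \<open>b'\<close> in the interval above \<open>a\<close>, and \<open>x = (x \<squnion> b) \<sqinter> (x \<squnion> b')\<close> embeds that interval into
  the product of the two smaller intervals above \<open>b\<close> and \<open>b'\<close>
  (\<open>finite_if_complemented_ascending_chains\<close>).

  For the Stone space, an ideal \<open>I\<close> gives the open set of the prime filters that meet \<open>I\<close>. By the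
  prime filter theorem (\<open>prime_filter_avoiding_ideal\<close>), disjointness and covering can be tested on
  points, so if this open set is closed, its complement comes from an ideal complementary to \<open>I\<close>.\<close>

section \<open>Ideals generated by complemented elements\<close>

definition has_complemented_generator :: "'a::bounded_lattice set \<Rightarrow> bool"
  where "has_complemented_generator I \<longleftrightarrow> (\<exists>i. complemented i \<and> I = {..i})"

lemma is_ideal_botD: "is_ideal I \<Longrightarrow> bot \<in> I"
  by (simp add: is_ideal_def)

lemma is_ideal_downD: "is_ideal I \<Longrightarrow> a \<in> I \<Longrightarrow> b \<le> a \<Longrightarrow> b \<in> I"
  by (auto simp: is_ideal_def)

lemma is_ideal_supD: "is_ideal I \<Longrightarrow> a \<in> I \<Longrightarrow> b \<in> I \<Longrightarrow> sup a b \<in> I"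
  by (auto simp: is_ideal_def)

lemma is_ideal_atMost: "is_ideal {..a}"
  by (auto simp: is_ideal_def intro: order_trans)

lemma is_ideal_bot: "is_ideal {bot}"
  by (auto simp: is_ideal_def bot_unique)

text \<open>This criterion asks only that \<open>j\<close> annihilate \<open>I\<close>; that \<open>i\<close> bounds \<open>I\<close> follows
  by distributivity.\<close>

lemma has_complemented_generatorI:
  fixes I :: "'a::{distrib_lattice,bounded_lattice} set"
  assumes I: "is_ideal I" and i: "i \<in> I" and top: "sup i j = top"
    and disj: "\<And>x. x \<in> I \<Longrightarrow> inf x j = bot"
  shows "has_complemented_generator I"
proof -
  have "x \<le> i" if "x \<in> I" for x
  proof -
    have "x = inf x (sup i j)" by (simp add: top)
    also have "\<dots> = inf x i" using disj[OF that] by (simp add: inf_sup_distrib1)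
    finally show ?thesis by (simp add: le_iff_inf)
  qed
  then have "I = {..i}" using is_ideal_downD[OF I i] by auto
  then show ?thesis
    unfolding has_complemented_generator_def complemented_def using disj[OF i] top by blast
qed

definition ideal_join :: "'a::bounded_lattice set \<Rightarrow> 'a set \<Rightarrow> 'a set"
  where "ideal_join I J = {x. \<exists>i\<in>I. \<exists>j\<in>J. x \<le> sup i j}"

lemma is_ideal_ideal_join:
  assumes I: "is_ideal I" and J: "is_ideal J"
  shows "is_ideal (ideal_join I J)"
  unfolding is_ideal_def
proof (intro conjI ballI allI impI)
  show "bot \<in> ideal_join I J"
    using is_ideal_botD[OF I] is_ideal_botD[OF J] by (auto simp: ideal_join_def)
next
  fix a b assume "a \<in> ideal_join I J" "b \<le> a"
  then show "b \<in> ideal_join I J" by (auto simp: ideal_join_def intro: order_trans)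
next
  fix a b assume "a \<in> ideal_join I J" "b \<in> ideal_join I J"
  then obtain i j i' j' where *: "i \<in> I" "j \<in> J" "a \<le> sup i j" "i' \<in> I" "j' \<in> J" "b \<le> sup i' j'"
    by (auto simp: ideal_join_def)
  have "sup a b \<le> sup (sup i j) (sup i' j')" using * by (intro sup_mono)
  also have "\<dots> = sup (sup i i') (sup j j')" by (simp add: ac_simps)
  finally show "sup a b \<in> ideal_join I J"
    unfolding ideal_join_def using is_ideal_supD[OF I] is_ideal_supD[OF J] * by blast
qed

lemma subset_ideal_join:
  assumes "is_ideal I" "is_ideal J"
  shows "I \<subseteq> ideal_join I J" "J \<subseteq> ideal_join I J"
  unfolding ideal_join_def using is_ideal_botD[OF assms(1)] is_ideal_botD[OF assms(2)]
  by (auto intro: sup_ge1 sup_ge2)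

lemma finite_join_insert:
  "finite S \<Longrightarrow> finite_join (insert a S) = sup a (finite_join S)"
  unfolding finite_join_def by (simp add: insert_commute[of bot a])

lemma finite_join_in_ideal:
  assumes "is_ideal I" "finite S" "S \<subseteq> I"
  shows "finite_join S \<in> I"
  using assms(2,3)
  by (induction) (auto simp: finite_join_empty finite_join_insert is_ideal_botD[OF assms(1)]
      intro: is_ideal_supD[OF assms(1)])

definition annihilator :: "'a::bounded_lattice set \<Rightarrow> 'a set"
  where "annihilator I = {x. \<forall>w\<in>I. inf w x = bot}"

lemma is_ideal_annihilator:
  fixes I :: "'a::{distrib_lattice,bounded_lattice} set"
  shows "is_ideal (annihilator I)"
proof -
  have "inf w b = bot" if "inf w a = bot" "b \<le> a" for a b w :: 'a
    using inf_mono[OF order_refl that(2), of w] that(1) by (simp add: bot_unique)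
  then show ?thesis
    unfolding is_ideal_def annihilator_def by (auto simp: inf_sup_distrib1)
qed

text \<open>Below every nonzero element there is a nonzero element of \<open>I\<close> or of its annihilator. This
  is what makes the density hypotheses in the equivalent conditions applicable.\<close>

lemma ideal_or_annihilator_below:
  fixes I :: "'a::{distrib_lattice,bounded_lattice} set"
  assumes I: "is_ideal I" and "b \<noteq> bot"
  shows "\<exists>c\<in>I \<union> annihilator I. c \<noteq> bot \<and> c \<le> b"
proof (cases "\<exists>w\<in>I. inf w b \<noteq> bot")
  case True
  then show ?thesis using is_ideal_downD[OF I] inf_le1 inf_le2 by (metis UnI1)
next
  case False
  then have "b \<in> annihilator I" by (auto simp: annihilator_def)
  then show ?thesis using assms(2) by blast
qed

lemma has_complemented_generator_if_annihilator:
  fixes I :: "'a::{distrib_lattice,bounded_lattice} set"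
  assumes I: "is_ideal I" and top: "top \<in> ideal_join I (annihilator I)"
  shows "has_complemented_generator I"
proof -
  obtain i j where "i \<in> I" "j \<in> annihilator I" "sup i j = top"
    using top by (auto simp: ideal_join_def top_unique)
  then show ?thesis by (intro has_complemented_generatorI[OF I]) (auto simp: annihilator_def)
qed

section \<open>Complements in the Stone locale\<close>

lemma ideal_set_top: "ideal_set top = UNIV"
  unfolding top_stone_locale_def Inf_stone_locale.rep_eq by simp

lemma ideal_set_bot: "ideal_set bot = {bot}"
proof -
  have "ideal_set bot \<subseteq> ideal_set (Abs_stone_locale {bot})"
    by (simp flip: less_eq_stone_locale.rep_eq)
  then show ?thesis
    using is_ideal_botD[OF ideal_set_is_ideal] by (auto simp: Abs_stone_locale_inverse is_ideal_bot)
qed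

lemma ideal_set_sup: "ideal_set (sup L M) = ideal_join (ideal_set L) (ideal_set M)"
proof
  let ?K = "Abs_stone_locale (ideal_join (ideal_set L) (ideal_set M))"
  have K: "ideal_set ?K = ideal_join (ideal_set L) (ideal_set M)"
    by (simp add: Abs_stone_locale_inverse is_ideal_ideal_join ideal_set_is_ideal)
  have "sup L M \<le> ?K"
    by (intro sup_least)
      (simp_all add: less_eq_stone_locale.rep_eq K subset_ideal_join ideal_set_is_ideal)
  then show "ideal_set (sup L M) \<subseteq> ideal_join (ideal_set L) (ideal_set M)"
    by (simp add: less_eq_stone_locale.rep_eq K)
next
  have "ideal_set L \<subseteq> ideal_set (sup L M)" "ideal_set M \<subseteq> ideal_set (sup L M)"
    by (simp_all flip: less_eq_stone_locale.rep_eq)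
  then show "ideal_join (ideal_set L) (ideal_set M) \<subseteq> ideal_set (sup L M)"
    by (auto simp: ideal_join_def intro!: is_ideal_supD[OF ideal_set_is_ideal, of _ "sup L M"]
        elim!: is_ideal_downD[OF ideal_set_is_ideal, rotated])
qed

lemma complemented_stone_locale_iff:
  "complemented L \<longleftrightarrow> has_complemented_generator (ideal_set L)"
proof
  assume "complemented L"
  then obtain M where inf: "inf L M = bot" and sup: "sup L M = top" by (auto simp: complemented_def)
  have "ideal_join (ideal_set L) (ideal_set M) = UNIV"
    using sup ideal_set_sup[of L M] by (simp add: ideal_set_top)
  then have "top \<in> ideal_join (ideal_set L) (ideal_set M)" by simp
  then obtain i j where *: "i \<in> ideal_set L" "j \<in> ideal_set M" "sup i j = top"
    by (auto simp: ideal_join_def top_unique)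
  have "ideal_set L \<inter> ideal_set M = {bot}"
    using inf inf_stone_locale.rep_eq[of L M] by (simp add: ideal_set_bot)
  moreover have "inf x j \<in> ideal_set L \<inter> ideal_set M" if "x \<in> ideal_set L" for x
    using is_ideal_downD[OF ideal_set_is_ideal] that *(2) by (meson IntI inf_le1 inf_le2)
  ultimately show "has_complemented_generator (ideal_set L)"
    using * by (intro has_complemented_generatorI[OF ideal_set_is_ideal]) auto
next
  assume "has_complemented_generator (ideal_set L)"
  then obtain i j where i: "ideal_set L = {..i}" and j: "inf i j = bot" "sup i j = top"
    by (auto simp: has_complemented_generator_def complemented_def)
  define M where "M = Abs_stone_locale {..j}"
  have M: "ideal_set M = {..j}" by (simp add: M_def Abs_stone_locale_inverse is_ideal_atMost)
  have "{..i} \<inter> {..j} = {..inf i j}" by auto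
  then have "ideal_set (inf L M) = ideal_set bot"
    using j(1) by (auto simp: inf_stone_locale.rep_eq i M ideal_set_bot bot_unique)
  moreover have "x \<in> ideal_join {..i} {..j}" for x
    unfolding ideal_join_def mem_Collect_eq by (intro bexI[of _ i] bexI[of _ j]) (simp_all add: j(2))
  then have "ideal_set (sup L M) = ideal_set top"
    by (auto simp: ideal_set_sup ideal_set_top i M)
  ultimately show "complemented L"
    unfolding complemented_def by (auto simp: ideal_set_inject)
qed

lemma almost_discrete_stone_locale_iff:
  "almost_discrete_locale TYPE('a::{distrib_lattice,bounded_lattice} stone_locale) \<longleftrightarrow>
    (\<forall>I::'a set. is_ideal I \<longrightarrow> has_complemented_generator I)"
proof -
  have "(\<forall>L::'a stone_locale. has_complemented_generator (ideal_set L)) \<longleftrightarrow>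
      (\<forall>I\<in>range (ideal_set :: 'a stone_locale \<Rightarrow> _). has_complemented_generator I)" by blast
  then show ?thesis
    by (simp add: almost_discrete_locale_def complemented_stone_locale_iff
        type_definition.Rep_range[OF type_definition_stone_locale])
qed

section \<open>Prime filters and clopen subsets of the Stone space\<close>

text \<open>The complement of an ideal that is maximal among those containing \<open>I\<close> and omitting \<open>d\<close> is a
  prime filter: if \<open>a\<close> and \<open>b\<close> lie outside such an \<open>M\<close>, then \<open>d\<close> is below both \<open>m \<squnion> a\<close> and \<open>n \<squnion> b\<close>
  with \<open>m, n \<in> M\<close>, hence below \<open>(m \<squnion> n) \<squnion> (a \<sqinter> b)\<close>.\<close>

lemma prime_filter_avoiding_ideal:
  fixes I :: "'a::{distrib_lattice,bounded_lattice} set"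
  assumes I: "is_ideal I" and d: "d \<notin> I"
  shows "\<exists>F. prime_filter F \<and> d \<in> F \<and> F \<inter> I = {}"
proof -
  let ?A = "{K. is_ideal K \<and> I \<subseteq> K \<and> d \<notin> K}"
  have "\<exists>M\<in>?A. \<forall>X\<in>?A. M \<subseteq> X \<longrightarrow> X = M"
  proof (rule subset_Zorn_nonempty)
    show "?A \<noteq> {}" using I d by blast
  next
    fix \<C> assume ne: "\<C> \<noteq> {}" and ch: "subset.chain ?A \<C>"
    have sub: "\<C> \<subseteq> ?A" using ch by (simp add: subset.chain_def)
    have ideal: "is_ideal X" if "X \<in> \<C>" for X using sub that by blast
    have "is_ideal (\<Union>\<C>)"
      unfolding is_ideal_def
    proof (intro conjI ballI allI impI)
      obtain X where "X \<in> \<C>" using ne by blast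
      then show "bot \<in> \<Union>\<C>" using is_ideal_botD[OF ideal] by blast
    next
      fix a b assume "a \<in> \<Union>\<C>" and ba: "b \<le> a"
      then obtain X where X: "X \<in> \<C>" "a \<in> X" by blast
      then have "b \<in> X" using is_ideal_downD[OF ideal _ ba] by simp
      then show "b \<in> \<Union>\<C>" using X(1) by blast
    next
      fix a b assume "a \<in> \<Union>\<C>" "b \<in> \<Union>\<C>"
      then obtain X Y where XY: "X \<in> \<C>" "Y \<in> \<C>" "a \<in> X" "b \<in> Y" by blast
      moreover have "X \<subseteq> Y \<or> Y \<subseteq> X" using ch XY(1,2) by (auto simp: subset_chain_def)
      ultimately obtain Z where Z: "Z \<in> \<C>" "a \<in> Z" "b \<in> Z" by blast
      then have "sup a b \<in> Z" by (intro is_ideal_supD[OF ideal])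
      then show "sup a b \<in> \<Union>\<C>" using Z(1) by blast
    qed
    then show "\<Union>\<C> \<in> ?A" using ne sub by blast
  qed
  then obtain M where M: "is_ideal M" "I \<subseteq> M" "d \<notin> M"
    and max_above: "\<forall>X\<in>?A. M \<subseteq> X \<longrightarrow> X = M" by auto
  have max: "X = M" if "is_ideal X" "M \<subseteq> X" "d \<notin> X" for X
    using max_above M(2) that by (metis (mono_tags, lifting) mem_Collect_eq order_trans)
  have ex: "\<exists>m\<in>M. d \<le> sup m a" if "a \<notin> M" for a
  proof -
    let ?K = "ideal_join M {..a}"
    have "is_ideal ?K" "M \<subseteq> ?K" "{..a} \<subseteq> ?K"
      using is_ideal_ideal_join[OF M(1) is_ideal_atMost[of a]]
        subset_ideal_join[OF M(1) is_ideal_atMost[of a]] .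
    moreover from this have "?K \<noteq> M" using that by auto
    ultimately have "d \<in> ?K" using max by blast
    then obtain m a' where m: "m \<in> M" "d \<le> sup m a'" "a' \<le> a" by (auto simp: ideal_join_def)
    have "d \<le> sup m a" using m(2) sup_mono[OF order_refl m(3)] by (rule order_trans)
    then show ?thesis using m(1) by blast
  qed
  have meet: "inf a b \<notin> M" if a: "a \<notin> M" and b: "b \<notin> M" for a b
  proof
    assume ab: "inf a b \<in> M"
    obtain m n where mn: "m \<in> M" "n \<in> M" "d \<le> sup m a" "d \<le> sup n b"
      using ex[OF a] ex[OF b] by auto
    have "d \<le> sup (sup m n) a"
      by (rule order_trans[OF mn(3) sup_mono[OF sup_ge1 order_refl]])
    moreover have "d \<le> sup (sup m n) b"
      by (rule order_trans[OF mn(4) sup_mono[OF sup_ge2 order_refl]])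
    ultimately have "d \<le> sup (sup m n) (inf a b)" by (simp add: sup_inf_distrib1)
    then have "d \<in> M"
      by (rule is_ideal_downD[OF M(1) is_ideal_supD[OF M(1) is_ideal_supD[OF M(1) mn(1,2)] ab]])
    then show False using M(3) by simp
  qed
  have top: "top \<notin> M" using is_ideal_downD[OF M(1) _ top_greatest] M(3) by metis
  have "prime_filter (- M)"
    unfolding prime_filter_def
  proof (intro conjI ballI allI impI)
    fix a b assume "a \<in> - M" "a \<le> b"
    then show "b \<in> - M" using is_ideal_downD[OF M(1), of b a] by auto
  next
    fix a b assume "a \<in> - M" "b \<in> - M"
    then show "inf a b \<in> - M" using meet[of a b] by simp
  next
    fix a b assume "sup a b \<in> - M"
    then show "a \<in> - M \<or> b \<in> - M" using is_ideal_supD[OF M(1), of a b] by auto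
  qed (simp_all add: top is_ideal_botD[OF M(1)])
  then show ?thesis using M by blast
qed

lemma openin_stone_spaceI: "openin stone_space (\<Union>d\<in>S. stone_basic d)"
  unfolding openin_stone_space
  by (rule arbitrary_union_of_Union) (auto intro: arbitrary_union_of_inc)

lemma openin_stone_spaceD:
  assumes "openin stone_space U" "F \<in> U"
  shows "\<exists>d. F \<in> stone_basic d \<and> stone_basic d \<subseteq> U"
  using assms unfolding openin_stone_space union_of_def by blast

text \<open>If the open set \<open>U\<close> of an ideal \<open>I\<close> has an open complement \<open>V\<close>, then every \<open>d\<close> whose basic set lies
  in \<open>V\<close> annihilates \<open>I\<close>, since a prime filter containing a nonzero \<open>w \<sqinter> d\<close> would lie in both \<open>U\<close> and
  \<open>V\<close>. A prime filter avoiding \<open>I\<close> and its annihilator would lie in neither. Conversely, an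
  open set is the basic set of the generator of its ideal of basic subsets, and the complement of that
  generator defines the complementary basic set.\<close>

lemma almost_discrete_stone_space_iff:
  "almost_discrete_space (stone_space :: 'a::{distrib_lattice,bounded_lattice} set topology) \<longleftrightarrow>
    (\<forall>I::'a set. is_ideal I \<longrightarrow> has_complemented_generator I)"
proof (intro iffI allI impI)
  fix I :: "'a set"
  assume disc: "almost_discrete_space (stone_space :: 'a set topology)" and I: "is_ideal I"
  define U where "U = (\<Union>d\<in>I. stone_basic d)"
  define V where "V = topspace stone_space - U"
  have "openin stone_space U" unfolding U_def by (rule openin_stone_spaceI)
  then have V: "openin stone_space V"
    using disc by (auto simp: almost_discrete_space_def closedin_def V_def)
  let ?A = "annihilator I"
  have ann: "d \<in> ?A" if dV: "stone_basic d \<subseteq> V" for d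
    unfolding annihilator_def
  proof (intro CollectI ballI, rule ccontr)
    fix w assume w: "w \<in> I" "inf w d \<noteq> bot"
    then obtain F where F: "prime_filter F" "inf w d \<in> F"
      using prime_filter_avoiding_ideal[OF is_ideal_bot, of "inf w d"] by auto
    then have "F \<in> stone_basic w" "F \<in> stone_basic d"
      using stone_basic_inf[of w d] by (auto simp: stone_basic_def)
    then show False using dV w(1) by (auto simp: U_def V_def)
  qed
  have "top \<in> ideal_join I ?A"
  proof (rule ccontr)
    assume "top \<notin> ideal_join I ?A"
    then obtain F where F: "prime_filter F" "F \<inter> ideal_join I ?A = {}"
      using prime_filter_avoiding_ideal is_ideal_ideal_join[OF I is_ideal_annihilator] by blast
    then have disj: "F \<inter> I = {}" "F \<inter> ?A = {}"
      using subset_ideal_join[OF I is_ideal_annihilator] by blast+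
    then have "F \<in> V"
      using F(1) by (auto simp: V_def U_def topspace_stone_space stone_basic_def)
    then obtain d where "F \<in> stone_basic d" "stone_basic d \<subseteq> V"
      using openin_stone_spaceD[OF V] by blast
    then show False using ann disj(2) by (auto simp: stone_basic_def)
  qed
  then show "has_complemented_generator I" by (rule has_complemented_generator_if_annihilator[OF I])
next
  assume gen: "\<forall>I::'a set. is_ideal I \<longrightarrow> has_complemented_generator I"
  show "almost_discrete_space (stone_space :: 'a set topology)"
    unfolding almost_discrete_space_def
  proof (intro allI impI)
    fix U :: "'a set set" assume U: "openin stone_space U"
    define I where "I = {d. stone_basic d \<subseteq> U}"
    have basic: "stone_basic (bot::'a) = {}"
        "\<And>a b::'a. b \<le> a \<Longrightarrow> stone_basic b \<subseteq> stone_basic a"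
        "\<And>a b::'a. stone_basic (sup a b) \<subseteq> stone_basic a \<union> stone_basic b"
      by (auto simp: stone_basic_def prime_filter_def)
    have "is_ideal I"
      unfolding is_ideal_def I_def using basic by (simp, meson Un_least order_trans)
    then obtain i j where i: "I = {..i}" and j: "inf i j = bot" "sup i j = top"
      using gen by (auto simp: has_complemented_generator_def complemented_def)
    have "U = stone_basic i"
    proof
      show "stone_basic i \<subseteq> U" using i by (auto simp: I_def)
      show "U \<subseteq> stone_basic i"
      proof
        fix F assume "F \<in> U"
        then obtain d where d: "F \<in> stone_basic d" "stone_basic d \<subseteq> U"
          using openin_stone_spaceD[OF U] by blast
        then have "d \<le> i" using i by (auto simp: I_def)
        then show "F \<in> stone_basic i" using d(1) by (auto simp: stone_basic_def prime_filter_def)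
      qed
    qed
    moreover have "topspace stone_space - stone_basic i = stone_basic j"
    proof -
      have "i \<in> F \<longleftrightarrow> j \<notin> F" if "prime_filter F" for F
        using that j unfolding prime_filter_def by metis
      then show ?thesis by (auto simp: topspace_stone_space stone_basic_def)
    qed
    moreover have "openin stone_space (stone_basic j)" using openin_stone_spaceI[of "{j}"] by simp
    ultimately show "closedin stone_space U" using U by (simp add: closedin_def openin_subset)
  qed
qed

section \<open>Density conditions\<close>

text \<open>Applied to \<open>1\<close> and the ideal generated by \<open>I\<close> and its annihilator, the closure property
  gives a complemented generator. Conversely, if \<open>i\<close> generates \<open>I\<close> and has complement \<open>j\<close>, then
  \<open>a \<sqinter> j\<close> has no nonzero element of \<open>I\<close> below it, so it is \<open>0\<close> and \<open>a \<le> i\<close>.\<close>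

lemma dense_below_closed_iff:
  "(\<forall>(I :: 'a::{distrib_lattice,bounded_lattice} set) a. is_ideal I \<longrightarrow>
      (\<forall>b. b \<noteq> bot \<and> b \<le> a \<longrightarrow> (\<exists>c\<in>I. c \<noteq> bot \<and> c \<le> b)) \<longrightarrow> a \<in> I) \<longleftrightarrow>
    (\<forall>I::'a set. is_ideal I \<longrightarrow> has_complemented_generator I)"
proof (intro iffI allI impI)
  fix I :: "'a set"
  assume closed: "\<forall>(I :: 'a set) a. is_ideal I \<longrightarrow>
      (\<forall>b. b \<noteq> bot \<and> b \<le> a \<longrightarrow> (\<exists>c\<in>I. c \<noteq> bot \<and> c \<le> b)) \<longrightarrow> a \<in> I"
    and I: "is_ideal I"
  let ?K = "ideal_join I (annihilator I)"
  have "I \<union> annihilator I \<subseteq> ?K"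
    using subset_ideal_join[OF I is_ideal_annihilator] by (rule Un_least)
  then have "\<exists>c\<in>?K. c \<noteq> bot \<and> c \<le> b" if "b \<noteq> bot" for b
    using ideal_or_annihilator_below[OF I that] by (meson subsetD)
  then have "top \<in> ?K"
    using closed[THEN spec[of _ ?K], THEN spec[of _ top]] is_ideal_ideal_join[OF I is_ideal_annihilator]
    by simp
  then show "has_complemented_generator I" by (rule has_complemented_generator_if_annihilator[OF I])
next
  fix I :: "'a set" and a
  assume gen: "\<forall>I::'a set. is_ideal I \<longrightarrow> has_complemented_generator I" and "is_ideal I"
    and dense: "\<forall>b. b \<noteq> bot \<and> b \<le> a \<longrightarrow> (\<exists>c\<in>I. c \<noteq> bot \<and> c \<le> b)"
  then obtain i j where i: "I = {..i}" and j: "inf i j = bot" "sup i j = top"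
    by (auto simp: has_complemented_generator_def complemented_def)
  have "inf a j = bot"
  proof (rule ccontr)
    assume "inf a j \<noteq> bot"
    then have "\<exists>c\<in>{..i}. c \<noteq> bot \<and> c \<le> inf a j"
      using dense[THEN spec[of _ "inf a j"]] by (simp add: i)
    then obtain c where "c \<le> i" "c \<noteq> bot" "c \<le> inf a j" by auto
    then have "c \<le> inf i j" by simp
    then show False using j(1) \<open>c \<noteq> bot\<close> by (simp add: bot_unique)
  qed
  then have "inf a (sup i j) = inf a i" by (simp add: inf_sup_distrib1)
  then show "a \<in> I" by (simp add: i j(2) le_iff_inf)
qed

text \<open>One direction applies the covering property to the nonzero elements of an ideal and its
  annihilator. The other applies \<open>dense_below_closed_iff\<close> to \<open>1\<close> and the ideal generated by the
  dense family: below any nonzero \<open>b\<close> it contains some nonzero \<open>a i \<sqinter> b\<close>.\<close>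

lemma dense_families_finitely_cover_iff:
  "dense_families_finitely_cover TYPE('a::{distrib_lattice,bounded_lattice}) \<longleftrightarrow>
    (\<forall>I::'a set. is_ideal I \<longrightarrow> has_complemented_generator I)"
proof (intro iffI allI impI)
  fix I :: "'a set"
  assume cover: "dense_families_finitely_cover TYPE('a)" and I: "is_ideal I"
  let ?S = "(I \<union> annihilator I) - {bot}"
  have "dense_family ?S (\<lambda>x. x)"
    unfolding dense_family_def
  proof (intro conjI ballI allI impI)
    fix b :: 'a assume "b \<noteq> bot"
    then obtain c where c: "c \<in> I \<union> annihilator I" "c \<noteq> bot" "c \<le> b"
      using ideal_or_annihilator_below[OF I] by blast
    then show "\<exists>c\<in>?S. inf c b \<noteq> bot" by (intro bexI[of _ c]) (simp_all add: inf.absorb1)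
  qed simp
  then obtain J where J: "finite J" "J \<subseteq> ?S" "top = finite_join ((\<lambda>x. x) ` J)"
    using cover unfolding dense_families_finitely_cover_def by blast
  have "J \<subseteq> ideal_join I (annihilator I)"
    using J(2) subset_ideal_join[OF I is_ideal_annihilator] by blast
  then have "top \<in> ideal_join I (annihilator I)"
    using finite_join_in_ideal[OF is_ideal_ideal_join[OF I is_ideal_annihilator] J(1)] J(3) by simp
  then show "has_complemented_generator I" by (rule has_complemented_generator_if_annihilator[OF I])
next
  assume gen: "\<forall>I::'a set. is_ideal I \<longrightarrow> has_complemented_generator I"
  show "dense_families_finitely_cover TYPE('a)"
    unfolding dense_families_finitely_cover_def
  proof (intro allI impI)
    fix I :: "'a set" and a :: "'a \<Rightarrow> 'a" assume dense: "dense_family I a"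
    define K where "K = {x. \<exists>J. finite J \<and> J \<subseteq> I \<and> x \<le> finite_join (a ` J)}"
    have join_Un: "finite_join (A \<union> B) = sup (finite_join A) (finite_join B)"
      if "finite A" "finite B" for A B :: "'a set"
      using that(1) by induction (simp_all add: finite_join_empty finite_join_insert that(2) sup_assoc)
    have K: "is_ideal K"
      unfolding is_ideal_def
    proof (intro conjI ballI allI impI)
      show "bot \<in> K" by (auto simp: K_def)
    next
      fix x y assume "x \<in> K" "y \<le> x"
      then show "y \<in> K" by (auto simp: K_def intro: order_trans)
    next
      fix x y assume "x \<in> K" "y \<in> K"
      then obtain J J' where J: "finite J" "J \<subseteq> I" "x \<le> finite_join (a ` J)"
          "finite J'" "J' \<subseteq> I" "y \<le> finite_join (a ` J')"
        by (auto simp: K_def)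
      then have "sup x y \<le> finite_join (a ` (J \<union> J'))"
        unfolding image_Un by (simp add: join_Un sup_mono le_supI1 le_supI2)
      then show "sup x y \<in> K" unfolding K_def using J by (metis (mono_tags) finite_UnI Un_least mem_Collect_eq)
    qed
    have "\<exists>c\<in>K. c \<noteq> bot \<and> c \<le> b" if "b \<noteq> bot" for b
    proof -
      have "\<exists>i\<in>I. inf (a i) b \<noteq> bot" using dense that by (simp add: dense_family_def)
      then obtain i where i: "i \<in> I" "inf (a i) b \<noteq> bot" ..
      have "inf (a i) b \<in> K"
        unfolding K_def using i(1)
        by (auto intro!: exI[of _ "{i}"] simp: finite_join_insert finite_join_empty)
      then show ?thesis using i(2) by (meson inf_le2)
    qed
    then have "top \<in> K"
      using gen[folded dense_below_closed_iff, THEN spec[of _ K], THEN spec[of _ top]] K by simp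
    then show "\<exists>J. finite J \<and> J \<subseteq> I \<and> top = finite_join (a ` J)"
      by (auto simp: K_def top_unique)
  qed
qed

section \<open>Finite Boolean algebras\<close>

text \<open>The elements below some member of an ascending sequence form an ideal, and its generator
  already lies below one member, after which the sequence cannot increase strictly.\<close>

lemma wf_greater_if_ideals_principal:
  assumes "\<And>I::'a::bounded_lattice set. is_ideal I \<Longrightarrow> \<exists>i. I = {..i}"
  shows "wf {(x, y::'a). y < x}"
  unfolding wf_iff_no_infinite_down_chain
proof
  assume "\<exists>f. \<forall>n. (f (Suc n), f n) \<in> {(x, y::'a). y < x}"
  then obtain f :: "nat \<Rightarrow> 'a" where f: "\<And>n. f n < f (Suc n)" by auto
  then have mono: "mono f" by (auto simp: mono_iff_le_Suc less_imp_le)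
  define I where "I = {x. \<exists>n. x \<le> f n}"
  have "is_ideal I"
    unfolding is_ideal_def
  proof (intro conjI ballI allI impI)
    fix x y assume "x \<in> I" "y \<in> I"
    then obtain m n where "x \<le> f m" "y \<le> f n" by (auto simp: I_def)
    then have "sup x y \<le> f (max m n)"
      using monoD[OF mono, of m "max m n"] monoD[OF mono, of n "max m n"]
      by (auto intro: order_trans)
    then show "sup x y \<in> I" by (auto simp: I_def)
  qed (auto simp: I_def intro: order_trans)
  then obtain i where i: "I = {..i}" using assms by blast
  then obtain n where n: "i \<le> f n" by (auto simp: I_def)
  have "f (Suc n) \<in> I" by (auto simp: I_def)
  then have "f (Suc n) \<le> f n" using i n by auto
  then show False using f[of n] by simp
qed

text \<open>Noetherian induction shows that each interval from \<open>a\<close> to \<open>1\<close> is finite. If it has an element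
  \<open>b\<close> strictly inside, then \<open>b\<close> has a relative complement \<open>b'\<close> there, and by distributivity every
  \<open>x \<ge> a\<close> is the meet of \<open>x \<squnion> b\<close> and \<open>x \<squnion> b'\<close>, which range over smaller intervals.\<close>

lemma finite_if_complemented_ascending_chains:
  assumes compl: "\<And>a::'a::{distrib_lattice,bounded_lattice}. complemented a"
    and wf: "wf {(x, y::'a). y < x}"
  shows "finite (UNIV :: 'a set)"
proof -
  have "finite {a..}" for a :: 'a
    using wf
  proof (induction a rule: wf_induct_rule)
    case (less a)
    show ?case
    proof (cases "\<exists>b. a < b \<and> b < top")
      case False
      then have "{a..} \<subseteq> {a, top}" by (auto simp: less_le)
      then show ?thesis by (rule finite_subset) simp
    next
      case True
      then obtain b where b: "a < b" "b < top" by blast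
      obtain n where n: "inf b n = bot" "sup b n = top" using compl by (auto simp: complemented_def)
      define b' where "b' = sup a n"
      have bb': "inf b b' = a"
        using b(1) n(1) by (simp add: b'_def inf_sup_distrib1 inf.absorb2 less_imp_le)
      have top: "sup b b' = top" using n(2) by (simp add: b'_def sup.left_commute)
      \<comment> \<open>If \<open>b'\<close> were \<open>a\<close>, then \<open>b = b \<squnion> b'\<close> would be \<open>1\<close>.\<close>
      have "a < b'"
        using b top by (auto simp: b'_def less_le sup.absorb1)
      then have fin: "finite {b..}" "finite {b'..}" using less b(1) by auto
      have "{a..} \<subseteq> (\<lambda>(y, z). inf y z) ` ({b..} \<times> {b'..})"
      proof
        fix x assume "x \<in> {a..}"
        then have "x = inf (sup x b) (sup x b')"
          by (simp add: bb' sup.absorb1 flip: sup_inf_distrib1)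
        then show "x \<in> (\<lambda>(y, z). inf y z) ` ({b..} \<times> {b'..})"
          by (intro image_eqI[of _ _ "(sup x b, sup x b')"]) auto
      qed
      then show ?thesis using fin by (meson finite_SigmaI finite_imageI finite_subset)
    qed
  qed
  from this[of bot] show ?thesis by (simp add: atLeast_def)
qed

lemma is_boolean_algebra_iff:
  "is_boolean_algebra TYPE('a::{distrib_lattice,bounded_lattice}) \<longleftrightarrow> (\<forall>a::'a. complemented a)"
proof
  assume "is_boolean_algebra TYPE('a)"
  then obtain diff and compl :: "'a \<Rightarrow> 'a"
    where "class.boolean_algebra diff compl inf (\<le>) (<) sup bot (top::'a)"
    by (auto simp: is_boolean_algebra_def)
  then interpret B: boolean_algebra diff compl inf "(\<le>)" "(<)" sup bot "top::'a" .
  show "\<forall>a::'a. complemented a"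
    unfolding complemented_def using B.inf_compl_bot B.sup_compl_top by blast
next
  assume "\<forall>a::'a. complemented a"
  then obtain compl where "\<And>a::'a. inf a (compl a) = bot \<and> sup a (compl a) = top"
    unfolding complemented_def by metis
  then have "class.boolean_algebra (\<lambda>x y. inf x (compl y)) compl inf (\<le>) (<) sup bot (top::'a)"
    by unfold_locales auto
  then show "is_boolean_algebra TYPE('a)" unfolding is_boolean_algebra_def by blast
qed

lemma finite_boolean_if_ideals_generated:
  assumes gen: "\<And>I::'a::{distrib_lattice,bounded_lattice} set.
    is_ideal I \<Longrightarrow> has_complemented_generator I"
  shows "finite (UNIV :: 'a set) \<and> is_boolean_algebra TYPE('a)"
proof -
  have compl: "complemented a" for a :: 'a
  proof -
    obtain i where "complemented i" "{..a} = {..i}"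
      using gen[OF is_ideal_atMost] by (auto simp: has_complemented_generator_def)
    then show ?thesis by simp
  qed
  moreover have "finite (UNIV :: 'a set)"
    using finite_if_complemented_ascending_chains[OF compl wf_greater_if_ideals_principal]
      gen by (auto simp: has_complemented_generator_def)
  ultimately show ?thesis by (simp add: is_boolean_algebra_iff)
qed

section \<open>Completeness with finitely attained suprema\<close>

text \<open>Suprema are finite joins, and the infimum of \<open>S\<close> is the supremum of its lower bounds.\<close>

lemma finite_imp_order_complete:
  assumes "finite (UNIV :: 'a::bounded_lattice set)"
  shows "order_complete TYPE('a)"
  unfolding order_complete_def
proof (intro allI conjI)
  fix S :: "'a set"
  have fin: "finite T" for T :: "'a set" using assms by (rule rev_finite_subset) simp
  show "\<exists>s. isLub UNIV S s" using isLub_finite_join[OF fin] by blast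
  have "isLub UNIV {x. x <=* S} (finite_join {x. x <=* S})" by (rule isLub_finite_join[OF fin])
  then have "isGlb UNIV S (finite_join {x. x <=* S})"
    by (auto simp: isGlb_def greatestP_def isLb_def isLub_def leastP_def isUb_def setle_def setge_def)
  then show "\<exists>i. isGlb UNIV S i" by blast
qed

lemma ideals_generated_if_finite_suprema:
  fixes I :: "'a::{distrib_lattice,bounded_lattice} set"
  assumes compl: "\<And>a::'a. complemented a" and complete: "order_complete TYPE('a)"
    and attained: "\<And>(S :: 'a set) s. isLub UNIV S s \<Longrightarrow> \<exists>J. finite J \<and> J \<subseteq> S \<and> s = finite_join J"
    and I: "is_ideal I"
  shows "has_complemented_generator I"
proof -
  obtain s where s: "isLub UNIV I s" using complete by (auto simp: order_complete_def)
  then obtain J where "finite J" "J \<subseteq> I" "s = finite_join J" using attained by blast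
  then have "s \<in> I" using finite_join_in_ideal[OF I] by simp
  moreover have "x \<le> s" if "x \<in> I" for x using isLubD2[OF s that] .
  ultimately have "I = {..s}" using is_ideal_downD[OF I] by auto
  then show ?thesis using compl by (auto simp: has_complemented_generator_def)
qed

lemma finite_suprema_if_finite_boolean:
  assumes fin: "finite (UNIV :: 'a::{distrib_lattice,bounded_lattice} set)"
    and "is_boolean_algebra TYPE('a)"
  shows "(\<forall>a::'a. complemented a) \<and> order_complete TYPE('a) \<and>
    (\<forall>(S :: 'a set) s. isLub UNIV S s \<longrightarrow> (\<exists>J. finite J \<and> J \<subseteq> S \<and> s = finite_join J))"
proof (intro conjI allI impI)
  show "complemented a" for a :: 'a using assms(2) by (simp add: is_boolean_algebra_iff)
  show "order_complete TYPE('a)" by (rule finite_imp_order_complete[OF fin])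
  fix S :: "'a set" and s assume s: "isLub UNIV S s"
  have S: "finite S" using fin by (rule rev_finite_subset) simp
  have "s = finite_join S"
    using isLub_le_isUb[OF s isLub_isUb[OF isLub_finite_join[OF S]]]
      isLub_le_isUb[OF isLub_finite_join[OF S] isLub_isUb[OF s]] by (rule order_antisym)
  with S show "\<exists>J. finite J \<and> J \<subseteq> S \<and> s = finite_join J" by blast
qed

theorem proposition7p7:
  shows "(almost_discrete_locale TYPE('a::{distrib_lattice,bounded_lattice} stone_locale)
        \<longleftrightarrow> almost_discrete_space (stone_space :: 'a set topology)) \<and>
     (almost_discrete_locale TYPE('a stone_locale)
        \<longleftrightarrow> (\<forall>(I :: 'a set) a. is_ideal I \<longrightarrow>
              (\<forall>b. b \<noteq> bot \<and> b \<le> a \<longrightarrow> (\<exists>c\<in>I. c \<noteq> bot \<and> c \<le> b)) \<longrightarrow> a \<in> I)) \<and>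
     (almost_discrete_locale TYPE('a stone_locale)
        \<longleftrightarrow> dense_families_finitely_cover TYPE('a)) \<and>
     (almost_discrete_locale TYPE('a stone_locale)
        \<longleftrightarrow> (\<forall>a::'a. complemented a) \<and> order_complete TYPE('a) \<and>
            (\<forall>(S :: 'a set) s. isLub UNIV S s \<longrightarrow>
               (\<exists>J. finite J \<and> J \<subseteq> S \<and> s = finite_join J))) \<and>
     (almost_discrete_locale TYPE('a stone_locale)
        \<longleftrightarrow> finite (UNIV :: 'a set) \<and> is_boolean_algebra TYPE('a))"
    (is "(?L \<longleftrightarrow> ?X) \<and> (?L \<longleftrightarrow> ?ii) \<and> (?L \<longleftrightarrow> ?iii) \<and> (?L \<longleftrightarrow> ?iv) \<and> (?L \<longleftrightarrow> ?v)")
proof -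
  have "?L \<longleftrightarrow> ?X"
    unfolding almost_discrete_stone_locale_iff almost_discrete_stone_space_iff ..
  moreover have "?L \<longleftrightarrow> ?ii"
    unfolding almost_discrete_stone_locale_iff dense_below_closed_iff ..
  moreover have "?L \<longleftrightarrow> ?iii"
    unfolding almost_discrete_stone_locale_iff dense_families_finitely_cover_iff ..
  moreover have "?L \<Longrightarrow> ?v"
    unfolding almost_discrete_stone_locale_iff by (rule finite_boolean_if_ideals_generated) blast
  moreover have "?v \<Longrightarrow> ?iv" using finite_suprema_if_finite_boolean by blast
  moreover have "?iv \<Longrightarrow> ?L"
    unfolding almost_discrete_stone_locale_iff using ideals_generated_if_finite_suprema by blast
  ultimately show ?thesis by argo
qed

end
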